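(* Let $R$ be a weakly $\sigma$-distributive Dedekind complete algebra, $(T,d)$ a compact metric space with Borel $\sigma$-algebra $\Sigma$, $\mu:\Sigma\to R$ a positive additive regular mapping, $F:T\to 2^R$ a multifunction and $E\in\Sigma$. Then the $( * )$-integral $\Phi(F,E)$ satisfies $$\Phi(F,E)=\bigcup_{(a_{i,j})_{i,j}}\ \bigcap_{\varphi\in\mathbb{N}^{\mathbb{N}}}\ \bigcup_{\gamma}\ \bigcap_{\{(E_i,t_i):i=1,\dots,k\}\in\Pi_\gamma}\mathcal{U}\left(\sum_{i=1}^{k}F(t_i)\mu(E_i),\ \bigvee_{i=1}^{\infty}a_{i,\varphi(i)}\right),$$ where $(a_{i,j})_{i,j}$ ranges over all $(D)$-sequences in $R$, $\gamma$ over all gages on $T$, and $\Pi_\gamma$ is the set of $\gamma$-fine partitions of $E$. Moreover, if $u\in R$, $u\ge 0$, is a bound for $F$, i.e. $F(t)\subset[-u,u]$ for all $t\in T$, then $u\,\mu(T)$ is a bound for $\Phi(F,E)$ for every $E\in\Sigma$, i.e. $\Phi(F,E)\subset[-u\,\mu(T),u\,\mu(T)]$.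
   Context: A Riesz space $R$ is Dedekind complete if every nonempty subset bounded from above (below) has a supremum $\bigvee$ (infimum $\bigwedge$) in $R$. A $(D)$-sequence, or regulator, in $R$ is a bounded double sequence $(a_{i,j})_{i,j}$ with $a_{i,j}\ge a_{i,j+1}$ for all $i,j\in\mathbb{N}$ and $\bigwedge_j a_{i,j}=0$ for all $i$. A Dedekind complete $R$ is weakly $\sigma$-distributive if $\bigwedge_{\varphi\in\mathbb{N}^{\mathbb{N}}}\left(\bigvee_{i=1}^{\infty}a_{i,\varphi(i)}\right)=0$ for every $(D)$-sequence. A Dedekind complete Riesz space $R$ is an algebra if it carries a map $\cdot:R\times R\to R$ compatible with sums, order, suprema and infima: it is additive in each variable; if $r\ge s$ and $t\ge0$ then $r\cdot t\ge s\cdot t$ and $t\cdot r\ge t\cdot s$; and if a net $(a_\lambda)$ decreases to $0$ and $b\ge0$ then $b\cdot a_\lambda$ and $a_\lambda\cdot b$ decrease to $0$. $\mu$ is regular if for every $E\in\Sigma$ there is a $(D)$-sequence $(a^E_{i,j})_{i,j}$ such that for every $\varphi:\mathbb{N}\to\mathbb{N}$ there are a compact $K$ and an open $U$ with $K\subset E\subset U$ and $\mu(U\setminus K)\le\bigvee_i a^E_{i,\varphi(i)}$. A gage on $T$ is a map $\gamma:T\to\mathbb{R}^+$ (strictly positive reals). A partition of $E\in\Sigma$ is a finite family $\{(E_i,t_i):i=1,\dots,k\}$ with $E_i\in\Sigma$, $t_i\in E_i$, $\mu(E_i\cap E_j)=0$ for $i\ne j$ and $\bigcup_i E_i=E$;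 it is $\gamma$-fine if $d(w,t_i)<\gamma(t_i)$ for all $i$ and all $w\in E_i$. For $C\subset R$ and $r\in R$, $r\ge 0$, put $\mathcal{U}(C,r)=\{z\in R:\exists x\in C,\ |x-z|\le r\}$, and $\mathrm{cl}(C)=\bigcup_{(a_{i,j})}\bigcap_{\varphi\in\mathbb{N}^{\mathbb{N}}}\mathcal{U}(C,\bigvee_i a_{i,\varphi(i)})$, the union being over all $(D)$-sequences. For sets $A_1,\dots,A_n\subset R$, $\sum_{i=1}^nA_i:=\mathrm{cl}(A_1+\dots+A_n)$ (closure of the algebraic sum); for $C\subset R$ and $r\in R$, $C\,r=\{c\cdot r:c\in C\}$. The $( * )$-integral $\Phi(F,E)$ of $F:T\to2^R$ on $E\in\Sigma$ is the set of all $z\in R$ for which there is a $(D)$-sequence $(a_{i,j})_{i,j}$ such that for all $\varphi\in\mathbb{N}^{\mathbb{N}}$ there is a gage $\gamma$ such that for every $\gamma$-fine partition $\{(E_i,t_i):i=1,\dots,k\}$ of $E$ there is $c\in\sum_{i=1}^kF(t_i)\mu(E_i)$ with $|z-c|\le\bigvee_{i=1}^\infty a_{i,\varphi(i)}$.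
   Formalization: The bound on Φ(F,E) is stated under the added assumption that every gage γ admits a γ-fine partition of E; without it (e.g. E=(0,1], γ(t)=t/2) Π_γ is empty, Φ(F,E)=R, and the bound fails. *)

theory Defs
  imports "HOL-Analysis.Analysis" "HOL-Library.Lattice_Algebras"
begin

section \<open>Dedekind complete Riesz spaces and algebras\<close>

text \<open>
  The class \<open>lattice_ab_group_add_abs\<close> supplies the modulus \<open>\<bar>x\<bar> = sup x (- x)\<close>.
  In a conditionally complete lattice \<open>Sup\<close> and \<open>Inf\<close> are meaningful only for nonempty
  sets bounded on the relevant side, so boundedness is stated wherever it does not follow.
\<close>

class dedekind_complete_riesz =
  ordered_real_vector + lattice_ab_group_add_abs + conditionally_complete_lattice

definition (in dedekind_complete_riesz) net_decreases_to_zero ::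
  "'i set \<Rightarrow> ('i \<Rightarrow> 'i \<Rightarrow> bool) \<Rightarrow> ('i \<Rightarrow> 'a) \<Rightarrow> bool"
  where "net_decreases_to_zero \<Lambda> le a \<longleftrightarrow>
    \<Lambda> \<noteq> {} \<and> reflp_on \<Lambda> le \<and> transp_on \<Lambda> le \<and>
    (\<forall>l\<in>\<Lambda>. \<forall>m\<in>\<Lambda>. \<exists>n\<in>\<Lambda>. le l n \<and> le m n) \<and>
    (\<forall>l\<in>\<Lambda>. \<forall>m\<in>\<Lambda>. le l m \<longrightarrow> a m \<le> a l) \<and>
    bdd_below (a ` \<Lambda>) \<and> (INF l\<in>\<Lambda>. a l) = 0"

text \<open>
  The product is only required to be biadditive, monotone and order continuous; associativity,
  commutativity and a unit are not assumed. A class axiom cannot quantify over the index types of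
  nets, so the indices are taken from the space itself. The lemma \<open>net_mult_decreases_to_zero\<close>
  recovers arbitrary index types.
\<close>

class dedekind_complete_algebra = dedekind_complete_riesz + times +
  assumes mult_add_left: "(r + s) * t = r * t + s * t"
    and mult_add_right: "t * (r + s) = t * r + t * s"
    and mult_mono_left: "s \<le> r \<Longrightarrow> 0 \<le> t \<Longrightarrow> s * t \<le> r * t"
    and mult_mono_right: "s \<le> r \<Longrightarrow> 0 \<le> t \<Longrightarrow> t * s \<le> t * r"
    and net_mult_left: "net_decreases_to_zero (\<Lambda> :: 'a set) le a \<Longrightarrow> 0 \<le> b \<Longrightarrow>
      net_decreases_to_zero \<Lambda> le (\<lambda>l. b * a l)"
    and net_mult_right: "net_decreases_to_zero (\<Lambda> :: 'a set) le a \<Longrightarrow> 0 \<le> b \<Longrightarrow>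
      net_decreases_to_zero \<Lambda> le (\<lambda>l. a l * b)"

lemma net_mult_decreases_to_zero:
  fixes \<Lambda> :: "'i set" and a :: "'i \<Rightarrow> 'r::dedekind_complete_algebra"
  assumes net: "net_decreases_to_zero \<Lambda> le a" and b: "0 \<le> b"
  shows "net_decreases_to_zero \<Lambda> le (\<lambda>l. b * a l)"
    and "net_decreases_to_zero \<Lambda> le (\<lambda>l. a l * b)"
proof -
  have dir: "\<exists>n\<in>a ` \<Lambda>. n \<le> x \<and> n \<le> y" if "x \<in> a ` \<Lambda>" "y \<in> a ` \<Lambda>" for x y
  proof -
    from that obtain l m where lm: "l \<in> \<Lambda>" "m \<in> \<Lambda>" "x = a l" "y = a m"
      by auto
    moreover from net lm obtain n where "n \<in> \<Lambda>" "le l n" "le m n"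
      unfolding net_decreases_to_zero_def by meson
    ultimately show ?thesis
      using net unfolding net_decreases_to_zero_def by blast
  qed
  have r: "net_decreases_to_zero (a ` \<Lambda>) (\<lambda>x y. y \<le> x) (\<lambda>x. x)"
    using net dir unfolding net_decreases_to_zero_def
    by (auto simp: reflp_on_def transp_on_def)
  show "net_decreases_to_zero \<Lambda> le (\<lambda>l. b * a l)"
    using net net_mult_left[OF r b] b unfolding net_decreases_to_zero_def
    by (auto simp: image_image intro: mult_mono_right)
  show "net_decreases_to_zero \<Lambda> le (\<lambda>l. a l * b)"
    using net net_mult_right[OF r b] b unfolding net_decreases_to_zero_def
    by (auto simp: image_image intro: mult_mono_left)
qed

definition D_sequence :: "(nat \<Rightarrow> nat \<Rightarrow> 'r::dedekind_complete_riesz) \<Rightarrow> bool"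
  where "D_sequence a \<longleftrightarrow>
    bdd_above (range (\<lambda>(i, j). a i j)) \<and> bdd_below (range (\<lambda>(i, j). a i j)) \<and>
    (\<forall>i j. a i (Suc j) \<le> a i j) \<and> (\<forall>i. (INF j. a i j) = 0)"

definition weakly_sigma_distributive :: "'r::dedekind_complete_riesz itself \<Rightarrow> bool"
  where "weakly_sigma_distributive _ \<longleftrightarrow>
    (\<forall>a :: nat \<Rightarrow> nat \<Rightarrow> 'r. D_sequence a \<longrightarrow> (INF \<phi> :: nat \<Rightarrow> nat. SUP i. a i (\<phi> i)) = 0)"

section \<open>Regular set functions\<close>

definition regular_mapping ::
  "('t::topological_space set \<Rightarrow> 'r::dedekind_complete_riesz) \<Rightarrow> bool"
  where "regular_mapping \<mu> \<longleftrightarrow>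
    (\<forall>E\<in>sets borel. \<exists>a. D_sequence a \<and>
      (\<forall>\<phi> :: nat \<Rightarrow> nat. \<exists>K U. compact K \<and> open U \<and> K \<subseteq> E \<and> E \<subseteq> U \<and>
        \<mu> (U - K) \<le> (SUP i. a i (\<phi> i))))"

section \<open>Gages and fine partitions\<close>

definition gages :: "('t \<Rightarrow> real) set"
  where "gages = {\<gamma>. \<forall>t. 0 < \<gamma> t}"

text \<open>
  A finite family of pairs is a list, since a pair may occur more than once. The empty family is
  allowed; it is a partition only of the empty set.
\<close>

definition is_partition ::
  "('t::topological_space set \<Rightarrow> 'r::zero) \<Rightarrow> 't set \<Rightarrow> ('t set \<times> 't) list \<Rightarrow> bool"
  where "is_partition \<mu> E P \<longleftrightarrow>
    (\<forall>(A, t)\<in>set P. A \<in> sets borel \<and> t \<in> A) \<and>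
    (\<forall>i<length P. \<forall>j<length P. i \<noteq> j \<longrightarrow> \<mu> (fst (P ! i) \<inter> fst (P ! j)) = 0) \<and>
    (\<Union>(A, t)\<in>set P. A) = E"

definition is_fine :: "('t::metric_space \<Rightarrow> real) \<Rightarrow> ('t set \<times> 't) list \<Rightarrow> bool"
  where "is_fine \<gamma> P \<longleftrightarrow> (\<forall>(A, t)\<in>set P. \<forall>w\<in>A. dist w t < \<gamma> t)"

definition fine_partitions ::
  "('t::metric_space set \<Rightarrow> 'r::zero) \<Rightarrow> 't set \<Rightarrow> ('t \<Rightarrow> real) \<Rightarrow> ('t set \<times> 't) list set"
  where "fine_partitions \<mu> E \<gamma> = {P. is_partition \<mu> E P \<and> is_fine \<gamma> P}"

section \<open>The set-valued integral\<close>

definition nbhd :: "'r::dedekind_complete_riesz set \<Rightarrow> 'r \<Rightarrow> 'r set"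
  where "nbhd C r = {z. \<exists>x\<in>C. \<bar>x - z\<bar> \<le> r}"

definition D_closure :: "'r::dedekind_complete_riesz set \<Rightarrow> 'r set"
  where "D_closure C =
    (\<Union>a\<in>{a. D_sequence a}. \<Inter>\<phi> :: nat \<Rightarrow> nat. nbhd C (SUP i. a i (\<phi> i)))"

text \<open>
  The list sum below is the algebraic (Minkowski) sum of sets, which is \<open>{0}\<close> for the empty list.
\<close>

definition set_riemann_sum ::
  "('t set \<Rightarrow> 'r::dedekind_complete_algebra) \<Rightarrow> ('t \<Rightarrow> 'r set) \<Rightarrow> ('t set \<times> 't) list \<Rightarrow> 'r set"
  where "set_riemann_sum \<mu> F P = D_closure (\<Sum>(A, t)\<leftarrow>P. (\<lambda>c. c * \<mu> A) ` F t)"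

definition star_integral ::
  "('t::metric_space set \<Rightarrow> 'r::dedekind_complete_algebra) \<Rightarrow> ('t \<Rightarrow> 'r set) \<Rightarrow> 't set \<Rightarrow> 'r set"
  where "star_integral \<mu> F E = {z. \<exists>a. D_sequence a \<and>
    (\<forall>\<phi> :: nat \<Rightarrow> nat. \<exists>\<gamma>\<in>gages. \<forall>P\<in>fine_partitions \<mu> E \<gamma>.
      \<exists>c\<in>set_riemann_sum \<mu> F P. \<bar>z - c\<bar> \<le> (SUP i. a i (\<phi> i)))}"

text \<open>
  Since the tags lie in the members of the partition, a nonclosed set need not have a
  \<open>\<gamma>\<close>-fine partition: on \<open>{0<..1}\<close> take \<open>\<gamma> t = t / 2\<close>. The integral is then the whole space.
  Closed subsets of a compact space have \<open>\<gamma>\<close>-fine partitions for every gage \<open>\<gamma>\<close>.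
\<close>

lemma star_integral_eq_UNIV:
  assumes "\<gamma> \<in> gages" and "fine_partitions \<mu> E \<gamma> = {}"
  shows "star_integral \<mu> F E = UNIV"
proof -
  have "D_sequence (\<lambda>_ _. 0 :: 'b)"
    by (simp add: D_sequence_def case_prod_beta)
  then show ?thesis
    using assms unfolding star_integral_def by blast
qed

lemma fine_partitions_nonempty:
  fixes \<mu> :: "'t::metric_space set \<Rightarrow> 'r::zero"
  assumes "compact (UNIV :: 't set)" and "closed E" and "\<mu> {} = 0" and \<gamma>: "\<gamma> \<in> gages"
  shows "fine_partitions \<mu> E \<gamma> \<noteq> {}"
proof -
  have "compact E"
    using assms(1,2) by (metis compact_Int_closed inf_top_left)
  then obtain X where X: "X \<subseteq> E" "finite X" "E \<subseteq> (\<Union>t\<in>X. ball t (\<gamma> t))"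
  proof (rule compactE_image[where C = E and f = "\<lambda>t. ball t (\<gamma> t)"])
    show "E \<subseteq> (\<Union>t\<in>E. ball t (\<gamma> t))"
      using \<gamma> by (auto simp: gages_def)
  qed auto
  obtain xs where xs: "set xs = X" "distinct xs"
    using finite_distinct_list[OF X(2)] by blast
  define B where "B i = (E \<inter> ball (xs ! i) (\<gamma> (xs ! i)) - X - (\<Union>j<i. ball (xs ! j) (\<gamma> (xs ! j))))
      \<union> {xs ! i}" for i
  define P where "P = map (\<lambda>i. (B i, xs ! i)) [0..<length xs]"
  have setP: "set P = (\<lambda>i. (B i, xs ! i)) ` {..<length xs}"
    by (auto simp: P_def)
  have disj: "B i \<inter> B j = {}" if "i < length xs" "j < length xs" "i < j" for i j
    using that xs by (auto simp: B_def nth_eq_iff_index_eq)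
  have cover: "\<exists>i<length xs. w \<in> B i" if w: "w \<in> E" for w
  proof (cases "w \<in> X")
    case True
    then show ?thesis
      using xs by (auto simp: B_def in_set_conv_nth)
  next
    case False
    have ex: "\<exists>i. i < length xs \<and> w \<in> ball (xs ! i) (\<gamma> (xs ! i))"
      using w X(3) xs(1) by (metis UN_E in_set_conv_nth subsetD)
    define i where "i = (LEAST i. i < length xs \<and> w \<in> ball (xs ! i) (\<gamma> (xs ! i)))"
    have i: "i < length xs" "w \<in> ball (xs ! i) (\<gamma> (xs ! i))"
      using LeastI_ex[OF ex] by (auto simp: i_def)
    moreover have "w \<notin> ball (xs ! j) (\<gamma> (xs ! j))" if "j < i" for j
      using not_less_Least[of j "\<lambda>i. i < length xs \<and> w \<in> ball (xs ! i) (\<gamma> (xs ! i))",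
        folded i_def] that i(1) by (meson order.strict_trans)
    ultimately show ?thesis
      using w False by (auto simp: B_def)
  qed
  have "B i \<in> sets borel" for i
    unfolding B_def using assms(2) X(2)
    by (intro sets.Un sets.Diff sets.Int sets.finite_UN) (auto intro: borel_closed finite_imp_closed)
  moreover have "xs ! i \<in> B i" for i
    by (simp add: B_def)
  moreover have "(\<Union>(A, t)\<in>set P. A) = E"
  proof -
    have "B i \<subseteq> E" if "i < length xs" for i
      using that X(1) xs(1) by (auto simp: B_def)
    then have "(\<Union>i<length xs. B i) = E"
      using cover by blast
    then show ?thesis
      by (simp add: setP)
  qed
  moreover have "\<mu> (fst (P ! i) \<inter> fst (P ! j)) = 0" if "i < length P" "j < length P" "i \<noteq> j" for i j
    using that disj[of i j] disj[of j i] assms(3)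
    by (cases "i < j") (auto simp: P_def Int_commute)
  moreover have "is_fine \<gamma> P"
    using \<gamma> by (auto simp: is_fine_def setP B_def gages_def dist_commute)
  ultimately have "P \<in> fine_partitions \<mu> E \<gamma>"
    by (auto simp: fine_partitions_def is_partition_def setP)
  then show ?thesis
    by blast
qed

end

theory Submission
  imports Defs
begin

text \<open>
  The formula for the integral is its definition read through the neighbourhoods
  \<open>nbhd C r\<close>: the existence of \<open>c \<in> C\<close> with \<open>\<bar>z - c\<bar> \<le> r\<close> says that \<open>z \<in> nbhd C r\<close>, and
  the quantifiers become unions and intersections.

  The bound rests on two facts. First, the members of a partition overlap in null sets only, so
  additivity gives \<open>(\<Sum>i. \<mu> (E\<^sub>i)) = \<mu> E \<le> \<mu> UNIV\<close>, and by monotonicity of the product every element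
  of the algebraic sum of the sets \<open>F t\<^sub>i \<mu> (E\<^sub>i)\<close> lies in \<open>[-w, w]\<close> with \<open>w = u * \<mu> UNIV\<close>
  (\<open>partition_sum_le\<close>, \<open>minkowski_sum_bound\<close>). Secondly, an order interval absorbs errors
  controlled by a regulator: a point within \<open>\<Squnion>i. a i (\<phi> i)\<close> of \<open>[-w, w]\<close> for every \<open>\<phi>\<close>
  belongs to \<open>[-w, w]\<close>, because weak \<open>\<sigma>\<close>-distributivity makes the infimum of these errors zero
  (\<open>regulator_limit_bound\<close>). The second fact is used twice: to pass from the algebraic sum to
  its closure, and from the Riemann sums to the integral.
\<close>

section \<open>Limits along a regulator\<close>

text \<open>
  Each \<open>\<phi>\<close> gives \<open>\<bar>z\<bar> - w \<le> (SUP i. a i (\<phi> i))\<close> by the triangle inequality, and weak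
  \<open>\<sigma>\<close>-distributivity says that zero is the infimum of the right-hand sides. The approximating
  point \<open>x\<close> may depend on \<open>\<phi>\<close>, as it does for points of a closure and for Riemann sums.
\<close>

lemma regulator_limit_bound:
  fixes z w :: "'r::dedekind_complete_riesz"
  assumes "weakly_sigma_distributive TYPE('r)" and "D_sequence a"
    and near: "\<And>\<phi> :: nat \<Rightarrow> nat. \<exists>x. \<bar>x\<bar> \<le> w \<and> \<bar>z - x\<bar> \<le> (SUP i. a i (\<phi> i))"
  shows "\<bar>z\<bar> \<le> w"
proof -
  have "\<bar>z\<bar> - w \<le> (SUP i. a i (\<phi> i))" for \<phi> :: "nat \<Rightarrow> nat"
  proof -
    obtain x where x: "\<bar>x\<bar> \<le> w" "\<bar>z - x\<bar> \<le> (SUP i. a i (\<phi> i))"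
      using near by blast
    have "\<bar>z\<bar> \<le> \<bar>z - x\<bar> + \<bar>x\<bar>"
      using abs_triangle_ineq[of "z - x" x] by simp
    also have "\<dots> \<le> (SUP i. a i (\<phi> i)) + w"
      using x by (intro add_mono)
    finally show ?thesis
      by (simp add: diff_le_eq)
  qed
  then have "\<bar>z\<bar> - w \<le> (INF \<phi> :: nat \<Rightarrow> nat. SUP i. a i (\<phi> i))"
    by (intro cINF_greatest) auto
  also have "\<dots> = 0"
    using assms(1,2) by (simp add: weakly_sigma_distributive_def)
  finally show ?thesis
    by simp
qed

lemma D_closure_bound:
  fixes C :: "'r::dedekind_complete_riesz set"
  assumes "weakly_sigma_distributive TYPE('r)" and "\<And>x. x \<in> C \<Longrightarrow> \<bar>x\<bar> \<le> w"
    and "c \<in> D_closure C"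
  shows "\<bar>c\<bar> \<le> w"
proof -
  obtain a where "D_sequence a" "\<And>\<phi> :: nat \<Rightarrow> nat. c \<in> nbhd C (SUP i. a i (\<phi> i))"
    using assms(3) unfolding D_closure_def by blast
  then show ?thesis
    using assms(1,2) by (intro regulator_limit_bound) (auto simp: nbhd_def abs_minus_commute)
qed

section \<open>Positive additive set functions on partitions\<close>

locale positive_additive =
  fixes \<mu> :: "'t::topological_space set \<Rightarrow> 'r::ordered_ab_group_add"
  assumes nonneg: "A \<in> sets borel \<Longrightarrow> 0 \<le> \<mu> A"
    and additive: "A \<in> sets borel \<Longrightarrow> B \<in> sets borel \<Longrightarrow> A \<inter> B = {} \<Longrightarrow> \<mu> (A \<union> B) = \<mu> A + \<mu> B"
begin

lemma empty_zero: "\<mu> {} = 0"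
  using additive[of "{}" "{}"] by simp

lemma mono:
  assumes "A \<in> sets borel" "B \<in> sets borel" "A \<subseteq> B"
  shows "\<mu> A \<le> \<mu> B"
proof -
  have "\<mu> B = \<mu> A + \<mu> (B - A)"
    using additive[of A "B - A"] assms by (simp add: Un_absorb1)
  then show ?thesis
    using nonneg[of "B - A"] assms by simp
qed

lemma union_null_inter:
  assumes "A \<in> sets borel" "B \<in> sets borel" "\<mu> (A \<inter> B) = 0"
  shows "\<mu> (A \<union> B) = \<mu> A + \<mu> B"
proof -
  have "\<mu> (A \<union> B) = \<mu> A + \<mu> (B - A)"
    using additive[of A "B - A"] assms by simp
  moreover have "\<mu> B = \<mu> (A \<inter> B) + \<mu> (B - A)"
    using additive[of "A \<inter> B" "B - A"] assms(1,2) Un_Diff_Int[of B A] by (auto simp: Int_commute Un_commute)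
  ultimately show ?thesis
    using assms(3) by simp
qed

lemma union_of_null_sets:
  assumes "A \<in> sets borel" "B \<in> sets borel" "\<mu> A = 0" "\<mu> B = 0"
  shows "\<mu> (A \<union> B) = 0"
proof -
  have "\<mu> (A \<inter> B) = 0"
    using mono[of "A \<inter> B" A] nonneg[of "A \<inter> B"] assms by (intro antisym) auto
  then show ?thesis
    using union_null_inter assms by simp
qed

lemma null_inter_Union:
  assumes "A \<in> sets borel" "\<And>B. B \<in> set Bs \<Longrightarrow> B \<in> sets borel"
    and "\<And>B. B \<in> set Bs \<Longrightarrow> \<mu> (A \<inter> B) = 0"
  shows "\<mu> (A \<inter> \<Union>(set Bs)) = 0"
  using assms(2,3)
proof (induction Bs)
  case Nil
  then show ?case
    by (simp add: empty_zero)
next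
  case (Cons B Bs)
  have "\<mu> ((A \<inter> B) \<union> (A \<inter> \<Union>(set Bs))) = 0"
    using Cons assms(1) by (intro union_of_null_sets sets.Int sets.finite_Union) auto
  then show ?case
    by (simp add: Int_Un_distrib)
qed

text \<open>
  Pairwise null overlaps are enough for additivity over a finite family, because the overlap of one
  member with the union of the others is a finite union of null sets.
\<close>

lemma sum_almost_disjoint:
  assumes "\<And>B. B \<in> set Bs \<Longrightarrow> B \<in> sets borel"
    and "\<And>i j. i < j \<Longrightarrow> j < length Bs \<Longrightarrow> \<mu> (Bs ! i \<inter> Bs ! j) = 0"
  shows "(\<Sum>B\<leftarrow>Bs. \<mu> B) = \<mu> (\<Union>(set Bs))"
  using assms
proof (induction Bs)
  case Nil
  then show ?case
    by (simp add: empty_zero)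
next
  case (Cons B Bs)
  have IH: "(\<Sum>B\<leftarrow>Bs. \<mu> B) = \<mu> (\<Union>(set Bs))"
  proof (rule Cons.IH)
    show "\<mu> (Bs ! i \<inter> Bs ! j) = 0" if "i < j" "j < length Bs" for i j
      using Cons.prems(2)[of "Suc i" "Suc j"] that by simp
  qed (use Cons.prems(1) in auto)
  have "\<mu> (B \<inter> C) = 0" if C: "C \<in> set Bs" for C
  proof -
    obtain j where "j < length Bs" "C = Bs ! j"
      using C by (auto simp: in_set_conv_nth)
    then show ?thesis
      using Cons.prems(2)[of 0 "Suc j"] by simp
  qed
  then have "\<mu> (B \<inter> \<Union>(set Bs)) = 0"
    using Cons.prems(1) by (intro null_inter_Union) auto
  then have "\<mu> (B \<union> \<Union>(set Bs)) = \<mu> B + \<mu> (\<Union>(set Bs))"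
    using Cons.prems(1) by (intro union_null_inter sets.finite_Union) auto
  then show ?case
    using IH by simp
qed

lemma partition_sum_le:
  assumes P: "is_partition \<mu> E P"
  shows "(\<Sum>(A, t)\<leftarrow>P. \<mu> A) \<le> \<mu> UNIV"
proof -
  have borel: "B \<in> sets borel" if "B \<in> set (map fst P)" for B
    using P that by (auto simp: is_partition_def)
  have "(\<Sum>(A, t)\<leftarrow>P. \<mu> A) = (\<Sum>B\<leftarrow>map fst P. \<mu> B)"
    by (simp add: case_prod_beta' comp_def)
  also have "\<dots> = \<mu> (\<Union>(set (map fst P)))"
    using P by (intro sum_almost_disjoint borel) (auto simp: is_partition_def)
  also have "\<dots> \<le> \<mu> UNIV"
    using borel by (intro mono sets.finite_Union) auto
  finally show ?thesis .
qed

end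

section \<open>Order bounds for Riemann sums\<close>

lemma algebra_minus_mult_left:
  fixes a b :: "'r::dedekind_complete_algebra"
  shows "(- a) * b = - (a * b)"
proof -
  have "0 * b = 0"
    using mult_add_left[of 0 0 b] by simp
  then have "a * b + (- a) * b = 0"
    using mult_add_left[of a "- a" b] by simp
  then show ?thesis
    by (simp add: add_eq_0_iff)
qed

lemma algebra_mult_sum_list:
  fixes u :: "'r::dedekind_complete_algebra"
  shows "u * sum_list xs = (\<Sum>x\<leftarrow>xs. u * x)"
proof (induction xs)
  case Nil
  then show ?case
    using mult_add_right[of u 0 0] by simp
qed (simp add: mult_add_right)

lemma algebra_abs_mult_le:
  fixes c :: "'r::dedekind_complete_algebra"
  assumes "\<bar>c\<bar> \<le> u" "0 \<le> m"
  shows "\<bar>c * m\<bar> \<le> u * m"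
proof (rule abs_leI)
  show "c * m \<le> u * m"
    using abs_le_D1[OF assms(1)] assms(2) by (rule mult_mono_left)
  show "- (c * m) \<le> u * m"
    using mult_mono_left[OF abs_le_D2[OF assms(1)] assms(2)]
    by (simp add: algebra_minus_mult_left)
qed

lemma minkowski_sum_bound:
  fixes S :: "'i \<Rightarrow> 'r::{lattice_ab_group_add_abs} set"
  assumes "\<And>p x. p \<in> set ps \<Longrightarrow> x \<in> S p \<Longrightarrow> \<bar>x\<bar> \<le> b p"
    and "x \<in> (\<Sum>p\<leftarrow>ps. S p)"
  shows "\<bar>x\<bar> \<le> (\<Sum>p\<leftarrow>ps. b p)"
  using assms
proof (induction ps arbitrary: x)
  case Nil
  then show ?case
    by simp
next
  case (Cons p ps)
  then obtain y z where yz: "x = y + z" "y \<in> S p" "z \<in> (\<Sum>p\<leftarrow>ps. S p)"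
    by (auto elim: set_plus_elim)
  have "\<bar>y\<bar> + \<bar>z\<bar> \<le> b p + (\<Sum>p\<leftarrow>ps. b p)"
    using Cons yz by (intro add_mono) auto
  then show ?case
    using abs_triangle_ineq[of y z] yz(1) by (simp add: order.trans)
qed

lemma set_riemann_sum_bound:
  fixes \<mu> :: "'t::topological_space set \<Rightarrow> 'r::dedekind_complete_algebra"
  assumes "weakly_sigma_distributive TYPE('r)" and "positive_additive \<mu>"
    and u: "0 \<le> u" "\<And>t. F t \<subseteq> {- u..u}" and P: "is_partition \<mu> E P"
    and "c \<in> set_riemann_sum \<mu> F P"
  shows "\<bar>c\<bar> \<le> u * \<mu> UNIV"
proof (rule D_closure_bound[OF assms(1)])
  interpret positive_additive \<mu>
    by fact
  fix x assume "x \<in> (\<Sum>(A, t)\<leftarrow>P. (\<lambda>c. c * \<mu> A) ` F t)"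
  then have "\<bar>x\<bar> \<le> (\<Sum>(A, t)\<leftarrow>P. u * \<mu> A)"
  proof (rule minkowski_sum_bound[rotated])
    fix p y assume p: "p \<in> set P" and y: "y \<in> (case p of (A, t) \<Rightarrow> (\<lambda>c. c * \<mu> A) ` F t)"
    then obtain A t c where *: "p = (A, t)" "c \<in> F t" "y = c * \<mu> A"
      by (cases p) auto
    have "0 \<le> \<mu> A"
      using P p * by (intro nonneg) (auto simp: is_partition_def)
    moreover have "\<bar>c\<bar> \<le> u"
      using u(2)[of t] * by (intro abs_leI) (auto simp: minus_le_iff)
    ultimately show "\<bar>y\<bar> \<le> (case p of (A, t) \<Rightarrow> u * \<mu> A)"
      using * by (simp add: algebra_abs_mult_le)
  qed
  also have "\<dots> = u * (\<Sum>(A, t)\<leftarrow>P. \<mu> A)"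
    by (simp add: algebra_mult_sum_list case_prod_beta' comp_def)
  also have "\<dots> \<le> u * \<mu> UNIV"
    using partition_sum_le[OF P] u(1) by (rule mult_mono_right)
  finally show "\<bar>x\<bar> \<le> u * \<mu> UNIV" .
qed (use assms(6) in \<open>simp add: set_riemann_sum_def\<close>)

section \<open>The integral through neighbourhoods, and its bound\<close>

lemma star_integral_eq_nbhd:
  "star_integral \<mu> F E =
    (\<Union>a\<in>{a. D_sequence a}. \<Inter>\<phi> :: nat \<Rightarrow> nat. \<Union>\<gamma>\<in>gages. \<Inter>P\<in>fine_partitions \<mu> E \<gamma>.
      nbhd (set_riemann_sum \<mu> F P) (SUP i. a i (\<phi> i)))"
  unfolding star_integral_def nbhd_def by (auto simp: abs_minus_commute)

text \<open>
  The bound needs Riemann sums near \<open>z\<close> to compare with, hence a fine partition for each gage: by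
  \<open>star_integral_eq_UNIV\<close>, a single gage without one makes the integral the whole space.
\<close>

lemma star_integral_bound:
  fixes \<mu> :: "'t::metric_space set \<Rightarrow> 'r::dedekind_complete_algebra"
  assumes "weakly_sigma_distributive TYPE('r)" and "positive_additive \<mu>"
    and "0 \<le> u" "\<And>t. F t \<subseteq> {- u..u}"
    and nonempty: "\<And>\<gamma>. \<gamma> \<in> gages \<Longrightarrow> fine_partitions \<mu> E \<gamma> \<noteq> {}"
    and z: "z \<in> star_integral \<mu> F E"
  shows "\<bar>z\<bar> \<le> u * \<mu> UNIV"
proof -
  obtain a where a: "D_sequence a"
    and near: "\<And>\<phi> :: nat \<Rightarrow> nat. \<exists>\<gamma>\<in>gages. \<forall>P\<in>fine_partitions \<mu> E \<gamma>.
      \<exists>c\<in>set_riemann_sum \<mu> F P. \<bar>z - c\<bar> \<le> (SUP i. a i (\<phi> i))"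
    using z unfolding star_integral_def by blast
  show ?thesis
  proof (rule regulator_limit_bound[OF assms(1) a])
    fix \<phi> :: "nat \<Rightarrow> nat"
    obtain \<gamma> where \<gamma>: "\<gamma> \<in> gages" "\<forall>P\<in>fine_partitions \<mu> E \<gamma>.
        \<exists>c\<in>set_riemann_sum \<mu> F P. \<bar>z - c\<bar> \<le> (SUP i. a i (\<phi> i))"
      using near by blast
    then obtain P c where "is_partition \<mu> E P" "c \<in> set_riemann_sum \<mu> F P"
      "\<bar>z - c\<bar> \<le> (SUP i. a i (\<phi> i))"
      using nonempty[OF \<gamma>(1)] unfolding fine_partitions_def by blast
    then show "\<exists>c. \<bar>c\<bar> \<le> u * \<mu> UNIV \<and> \<bar>z - c\<bar> \<le> (SUP i. a i (\<phi> i))"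
      using set_riemann_sum_bound[where F = F, OF assms(1-4)] by blast
  qed
qed

theorem proposition11:
  fixes \<mu> :: "'t::metric_space set \<Rightarrow> 'r::dedekind_complete_algebra"
    and F :: "'t \<Rightarrow> 'r set" and E :: "'t set"
  assumes "weakly_sigma_distributive TYPE('r)"
    and "compact (UNIV :: 't set)"
    and "\<forall>A\<in>sets borel. 0 \<le> \<mu> A"
    and "\<forall>A\<in>sets borel. \<forall>B\<in>sets borel. A \<inter> B = {} \<longrightarrow> \<mu> (A \<union> B) = \<mu> A + \<mu> B"
    and "regular_mapping \<mu>"
    and "E \<in> sets borel"
  shows "star_integral \<mu> F E =
      (\<Union>a\<in>{a. D_sequence a}. \<Inter>\<phi> :: nat \<Rightarrow> nat. \<Union>\<gamma>\<in>gages. \<Inter>P\<in>fine_partitions \<mu> E \<gamma>.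
        nbhd (set_riemann_sum \<mu> F P) (SUP i. a i (\<phi> i))) \<and>
    ((\<forall>\<gamma>\<in>gages. fine_partitions \<mu> E \<gamma> \<noteq> {}) \<longrightarrow>
      (\<forall>u. 0 \<le> u \<and> (\<forall>t. F t \<subseteq> {- u..u}) \<longrightarrow>
        star_integral \<mu> F E \<subseteq> {- (u * \<mu> UNIV)..u * \<mu> UNIV}))"
proof (intro conjI impI allI subsetI)
  show "star_integral \<mu> F E =
      (\<Union>a\<in>{a. D_sequence a}. \<Inter>\<phi> :: nat \<Rightarrow> nat. \<Union>\<gamma>\<in>gages. \<Inter>P\<in>fine_partitions \<mu> E \<gamma>.
        nbhd (set_riemann_sum \<mu> F P) (SUP i. a i (\<phi> i)))"
    by (rule star_integral_eq_nbhd)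
next
  fix u z
  assume "\<forall>\<gamma>\<in>gages. fine_partitions \<mu> E \<gamma> \<noteq> {}" "0 \<le> u \<and> (\<forall>t. F t \<subseteq> {- u..u})"
    "z \<in> star_integral \<mu> F E"
  moreover have "positive_additive \<mu>"
    using assms(3,4) by unfold_locales auto
  ultimately have "\<bar>z\<bar> \<le> u * \<mu> UNIV"
    using star_integral_bound[OF assms(1)] by blast
  then show "z \<in> {- (u * \<mu> UNIV)..u * \<mu> UNIV}"
    using abs_le_D1 abs_le_D2 by (fastforce simp: minus_le_iff)
qed

end
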